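(* Let $G$ be a bipartite graph and let $G^c$ be its complement. Then $\mathrm{Fall}(G^c)\subseteq\{\chi(G^c)\}$. Moreover, the problem of deciding, given a bipartite graph $G$, whether or not $\mathrm{Fall}(G^c)=\{\chi(G^c)\}$ is solvable in polynomial time.
   Context: All graphs are finite, simple (undirected, no loops, no multiple edges), with nonempty vertex set. For $k\in\mathbb{N}=\{1,2,\dots\}$ let $[k]=\{1,\dots,k\}$. A (proper) $k$-coloring of a graph $G$ is a function $f:V(G)\to[k]$ such that each $f^{-1}(i)$ is an independent set; $\chi(G)$ is the chromatic number. A $k$-coloring $f$ is a fall $k$-coloring if $f(N[v])=[k]$ for every $v\in V(G)$, where $N[v]$ is the closed neighborhood of $v$. $\mathrm{Fall}(G)$ is the set of all positive integers $k$ such that $G$ has a fall $k$-coloring (possibly empty). *)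

theory Defs
  imports
    "Graph_Theory.Pair_Digraph"
    "HOL-Computational_Algebra.Polynomial"
begin

section \<open>Colorings and fall colorings\<close>

text \<open>
  The locale \<open>pair_graph\<close> describes finite digraphs without loops and without parallel arcs
  whose arc relation is symmetric, that is, finite simple undirected graphs:
  \<open>u\<close> and \<open>v\<close> are adjacent iff \<open>(u, v) \<in> parcs G\<close>.
  It admits the graph without vertices, which is excluded here.
\<close>

definition simple_graph :: "'a pair_pre_digraph \<Rightarrow> bool" where
  "simple_graph G \<longleftrightarrow> pair_graph G \<and> pverts G \<noteq> {}"

definition complement_graph :: "'a pair_pre_digraph \<Rightarrow> 'a pair_pre_digraph" where
  "complement_graph G =
     \<lparr>pverts = pverts G,
      parcs = {(u, v). u \<in> pverts G \<and> v \<in> pverts G \<and> u \<noteq> v \<and> (u, v) \<notin> parcs G}\<rparr>"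

definition independent_set :: "'a pair_pre_digraph \<Rightarrow> 'a set \<Rightarrow> bool" where
  "independent_set G S \<longleftrightarrow> S \<subseteq> pverts G \<and> (\<forall>u\<in>S. \<forall>v\<in>S. (u, v) \<notin> parcs G)"

definition bipartite :: "'a pair_pre_digraph \<Rightarrow> bool" where
  "bipartite G \<longleftrightarrow>
     (\<exists>A B. A \<union> B = pverts G \<and> A \<inter> B = {} \<and> independent_set G A \<and> independent_set G B)"

definition closed_neighborhood :: "'a pair_pre_digraph \<Rightarrow> 'a \<Rightarrow> 'a set" where
  "closed_neighborhood G v = insert v {u \<in> pverts G. (v, u) \<in> parcs G}"

text \<open>Only the values of a coloring on the vertices matter.\<close>

definition coloring :: "'a pair_pre_digraph \<Rightarrow> nat \<Rightarrow> ('a \<Rightarrow> nat) \<Rightarrow> bool" where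
  "coloring G k f \<longleftrightarrow>
     f ` pverts G \<subseteq> {1..k} \<and> (\<forall>i\<in>{1..k}. independent_set G {v \<in> pverts G. f v = i})"

definition chromatic_number :: "'a pair_pre_digraph \<Rightarrow> nat" where
  "chromatic_number G = (LEAST k. \<exists>f. coloring G k f)"

definition fall_coloring :: "'a pair_pre_digraph \<Rightarrow> nat \<Rightarrow> ('a \<Rightarrow> nat) \<Rightarrow> bool" where
  "fall_coloring G k f \<longleftrightarrow>
     coloring G k f \<and> (\<forall>v\<in>pverts G. f ` closed_neighborhood G v = {1..k})"

definition Fall :: "'a pair_pre_digraph \<Rightarrow> nat set" where
  "Fall G = {k. k \<ge> 1 \<and> (\<exists>f. fall_coloring G k f)}"

lemma simple_graph_complement_graph:
  assumes "simple_graph G"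
  shows "simple_graph (complement_graph G)"
proof -
  interpret pair_graph G
    using assms by (simp add: simple_graph_def)
  have fin: "finite {(u, v). u \<in> pverts G \<and> v \<in> pverts G \<and> u \<noteq> v \<and> (u, v) \<notin> parcs G}"
    by (rule finite_subset[where B = "pverts G \<times> pverts G"]) (auto simp: pair_finite_verts)
  have sym: "(v, u) \<in> parcs G \<Longrightarrow> (u, v) \<in> parcs G" for u v
    using arcs_symmetric by blast
  have "pair_graph (complement_graph G)"
    by standard
      (use fin sym in \<open>auto simp: complement_graph_def pair_finite_verts symmetric_def sym_def\<close>)
  then show ?thesis
    using assms by (simp add: simple_graph_def complement_graph_def)
qed


section \<open>Polynomial time\<close>

text \<open>
  The machine model is the random access machine with registers \<open>R 0, R 1, \<dots>\<close> holding natural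
  numbers, addition and truncated subtraction as the only arithmetic operations, indirect
  addressing, conditional jumps, and unit cost per instruction.  As there is no multiplication,
  a register has \<open>O(t)\<close> bits after \<open>t\<close> steps (for a fixed program), and such machines
  simulate, and are simulated by, multitape Turing machines with polynomial overhead
  (Cook and Reckhow, Time bounded random access machines, 1973).

  The input is a word over \<open>{0, 1}\<close> that can only be read, one symbol at a time; reading behind
  its end yields 2.  So a program receives nothing but the word, and finds out its length itself.
\<close>

datatype instr =
    Const nat nat      \<comment> \<open>\<open>Const i c\<close>: \<open>R i := c\<close>\<close>
  | Add nat nat nat    \<comment> \<open>\<open>Add i j k\<close>: \<open>R i := R j + R k\<close>\<close>
  | Sub nat nat nat    \<comment> \<open>\<open>Sub i j k\<close>: \<open>R i := R j - R k\<close>\<close>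
  | Load nat nat       \<comment> \<open>\<open>Load i j\<close>: \<open>R i := R (R j)\<close>\<close>
  | Store nat nat      \<comment> \<open>\<open>Store i j\<close>: \<open>R (R i) := R j\<close>\<close>
  | Read nat nat       \<comment> \<open>\<open>Read i j\<close>: \<open>R i :=\<close> input symbol at position \<open>R j\<close>\<close>
  | JumpPos nat nat    \<comment> \<open>\<open>JumpPos i l\<close>: go to instruction \<open>l\<close> if \<open>R i > 0\<close>\<close>

text \<open>A configuration consists of the program counter and the register contents.\<close>

type_synonym config = "nat \<times> (nat \<Rightarrow> nat)"

definition input_symbol :: "bool list \<Rightarrow> nat \<Rightarrow> nat" where
  "input_symbol w i = (if i < length w then of_bool (w ! i) else 2)"

fun exec :: "bool list \<Rightarrow> instr \<Rightarrow> config \<Rightarrow> config" where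
  "exec w (Const i c) (pc, R) = (pc + 1, R(i := c))"
| "exec w (Add i j k) (pc, R) = (pc + 1, R(i := R j + R k))"
| "exec w (Sub i j k) (pc, R) = (pc + 1, R(i := R j - R k))"
| "exec w (Load i j) (pc, R) = (pc + 1, R(i := R (R j)))"
| "exec w (Store i j) (pc, R) = (pc + 1, R(R i := R j))"
| "exec w (Read i j) (pc, R) = (pc + 1, R(i := input_symbol w (R j)))"
| "exec w (JumpPos i l) (pc, R) = (if R i > 0 then l else pc + 1, R)"

definition halted :: "instr list \<Rightarrow> config \<Rightarrow> bool" where
  "halted prog c \<longleftrightarrow> fst c \<ge> length prog"

definition step :: "instr list \<Rightarrow> bool list \<Rightarrow> config \<Rightarrow> config" where
  "step prog w c = (if halted prog c then c else exec w (prog ! fst c) c)"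

text \<open>The configuration reached after \<open>t\<close> steps; initially all registers contain 0.\<close>

definition run :: "instr list \<Rightarrow> bool list \<Rightarrow> nat \<Rightarrow> config" where
  "run prog w t = (step prog w ^^ t) (0, \<lambda>_. 0)"

text \<open>
  A decision problem is given by a set of instances, an encoding of the instances as words, and
  the property to be decided.  A single program has to halt on every instance within a number of
  steps that is polynomial in the length of the input word, with the answer (1 for yes, 0 for no)
  in register 0.  Nothing is required for words that do not encode an instance.
\<close>

definition decidable_in_polynomial_time ::
    "'i set \<Rightarrow> ('i \<Rightarrow> bool list) \<Rightarrow> ('i \<Rightarrow> bool) \<Rightarrow> bool" where
  "decidable_in_polynomial_time I enc P \<longleftrightarrow>
     (\<exists>prog (p :: nat poly). \<forall>x\<in>I. \<exists>t \<le> poly p (length (enc x)).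
        halted prog (run prog (enc x) t) \<and> snd (run prog (enc x) t) 0 = of_bool (P x))"

text \<open>
  As inputs, graphs have the vertices \<open>0, \<dots>, n - 1\<close> (every finite graph is isomorphic to one of
  these) and are given by their adjacency matrix, row by row, as a word of length \<open>n\<^sup>2\<close>.
\<close>

definition input_graph :: "nat pair_pre_digraph \<Rightarrow> bool" where
  "input_graph G \<longleftrightarrow> simple_graph G \<and> pverts G = {..<card (pverts G)}"

definition adjacency_word :: "nat pair_pre_digraph \<Rightarrow> bool list" where
  "adjacency_word G =
     (let n = card (pverts G) in [(i, j) \<in> parcs G. i \<leftarrow> [0..<n], j \<leftarrow> [0..<n]])"

end

(*
  A color class of the complement of a bipartite graph G is a vertex or an edge of G.  In a fall
  coloring a single vertex can only be a class if it is isolated in G, whereas an edge always may be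
  one, as G has no triangles.  So fall colorings of the complement are the matchings of G that cover
  exactly the non-isolated vertices.  Isolated vertices are classes of their own in every coloring,
  and all other classes have at most two elements, so such a matching uses the least number of colors.

  Existence of such a matching is decided by an auction on the adjacency matrix: every non-isolated
  vertex is a bidder as well as an object, a bidder who owns nothing takes the cheapest neighboring
  object from its owner and raises its price by 1.  If a perfect matching exists, then by Hall's
  condition no bid is made at a price above n, so that the auction ends within n^2 + n rounds.
  The parts of G need not be known, because an injection along edges that is defined on all
  non-isolated vertices restricts to a bijection from one part to the other.
*)

theory Submission
  imports Defs
begin

section \<open>Fall colorings of complements of bipartite graphs\<close>

locale bipartite_graph =
  fixes G :: "'a pair_pre_digraph"
  assumes simple: "simple_graph G" and bip: "bipartite G"
begin

abbreviation V where "V \<equiv> pverts G"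
abbreviation E where "E \<equiv> parcs G"
abbreviation nonisolated where "nonisolated v \<equiv> \<exists>u. (v, u) \<in> E"

section \<open>Edges and parts of a bipartite graph\<close>

lemma finite_V: "finite V" and V_nonempty: "V \<noteq> {}"
  using simple by (auto simp: simple_graph_def pair_graph_def pair_digraph_def
      pair_fin_digraph_def pair_fin_digraph_axioms_def)

lemma E_in_V: "(u, v) \<in> E \<Longrightarrow> u \<in> V" "(u, v) \<in> E \<Longrightarrow> v \<in> V"
proof -
  interpret pair_graph G using simple by (simp add: simple_graph_def)
  show "(u, v) \<in> E \<Longrightarrow> u \<in> V" "(u, v) \<in> E \<Longrightarrow> v \<in> V"
    using in_arcsD1 in_arcsD2 by auto
qed

lemma E_sym: "(u, v) \<in> E \<Longrightarrow> (v, u) \<in> E"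
proof -
  interpret pair_graph G using simple by (simp add: simple_graph_def)
  show "(u, v) \<in> E \<Longrightarrow> (v, u) \<in> E" using arcs_symmetric by blast
qed

lemma parts:
  obtains A B where "A \<union> B = V" "A \<inter> B = {}"
    "\<And>u v. (u, v) \<in> E \<Longrightarrow> u \<in> A \<longleftrightarrow> v \<in> B" "\<And>u v. (u, v) \<in> E \<Longrightarrow> u \<in> B \<longleftrightarrow> v \<in> A"
proof -
  obtain A B where AB: "A \<union> B = V" "A \<inter> B = {}" "independent_set G A" "independent_set G B"
    using bip by (auto simp: bipartite_def)
  have "u \<in> A \<longleftrightarrow> v \<in> B" "u \<in> B \<longleftrightarrow> v \<in> A" if "(u, v) \<in> E" for u v
    using AB that E_in_V[OF that] unfolding independent_set_def by blast+
  with AB show ?thesis using that by blast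
qed

lemma loopfree: "(v, v) \<notin> E"
  using parts E_in_V by (metis IntI UnE empty_iff)

lemma triangle_free: "(u, v) \<in> E \<Longrightarrow> (v, w) \<in> E \<Longrightarrow> (u, w) \<notin> E"
  using parts E_in_V by (metis IntI UnE empty_iff)

section \<open>Colorings and fall colorings of the complement\<close>

lemma coloring_complement_iff:
  "coloring (complement_graph G) k f \<longleftrightarrow>
    f ` V \<subseteq> {1..k} \<and> (\<forall>u\<in>V. \<forall>v\<in>V. f u = f v \<longrightarrow> u \<noteq> v \<longrightarrow> (u, v) \<in> E)"
  by (fastforce simp: coloring_def complement_graph_def independent_set_def)

lemma pverts_complement [simp]: "pverts (complement_graph G) = V"
  by (simp add: complement_graph_def)

lemma closed_neighborhood_complement:
  "v \<in> V \<Longrightarrow> closed_neighborhood (complement_graph G) v = {u \<in> V. (v, u) \<notin> E}"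
  using loopfree by (auto simp: closed_neighborhood_def complement_graph_def)

lemma fall_coloring_complement_iff:
  "fall_coloring (complement_graph G) k f \<longleftrightarrow>
    coloring (complement_graph G) k f \<and> (\<forall>v\<in>V. f ` {u \<in> V. (v, u) \<notin> E} = {1..k})"
  by (simp add: fall_coloring_def closed_neighborhood_complement cong: ball_cong)

text \<open>In the complement \<open>w\<close> must see the color of \<open>v\<close>, hence at a
  vertex that is not adjacent to \<open>w\<close> in \<open>G\<close>. As \<open>v\<close> is
  adjacent to \<open>w\<close>, this is another vertex.\<close>

lemma fall_coloring_mate:
  assumes f: "fall_coloring (complement_graph G) k f" and v: "(v, w) \<in> E"
  shows "\<exists>u\<in>V. u \<noteq> v \<and> f u = f v"
proof -
  have "f v \<in> {1..k}" "f ` {u \<in> V. (w, u) \<notin> E} = {1..k}"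
    using f E_in_V[OF v] by (auto simp: fall_coloring_complement_iff coloring_complement_iff)
  then have "f v \<in> f ` {u \<in> V. (w, u) \<notin> E}" by simp
  then obtain u where "u \<in> V" "(w, u) \<notin> E" "f u = f v" by auto
  moreover from this have "u \<noteq> v" using E_sym[OF v] by auto
  ultimately show ?thesis by blast
qed

section \<open>Minimality by double counting\<close>

text \<open>Color classes of the complement are vertices and edges of \<open>G\<close>.  Counting isolated
  vertices of \<open>G\<close> twice, every class weighs at most 2, and exactly 2 in a fall coloring.\<close>

definition weight :: "'a \<Rightarrow> nat" where
  "weight v = (if nonisolated v then 1 else 2)"

lemma class_weight_le:
  assumes "coloring (complement_graph G) k f"
  shows "sum weight {v \<in> V. f v = i} \<le> 2"
proof -
  let ?C = "{v \<in> V. f v = i}"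
  have adj: "(u, v) \<in> E" if "u \<in> ?C" "v \<in> ?C" "u \<noteq> v" for u v
    using assms that by (auto simp: coloring_complement_iff)
  show ?thesis
  proof (cases "\<exists>u\<in>?C. \<exists>v\<in>?C. u \<noteq> v")
    case True
    then obtain u v where uv: "u \<in> ?C" "v \<in> ?C" "u \<noteq> v" by blast
    have C: "?C = {u, v}" using adj triangle_free uv by blast
    have "weight u = 1" "weight v = 1" using adj[OF uv] E_sym by (auto simp: weight_def)
    then show ?thesis using uv(3) by (simp add: C)
  next
    case False
    then have "?C = {} \<or> (\<exists>v. ?C = {v})" by blast
    then show ?thesis by (elim disjE exE, simp_all only:) (auto simp: weight_def)
  qed
qed

lemma fall_class_weight_ge:
  assumes f: "fall_coloring (complement_graph G) k f" and i: "i \<in> {1..k}"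
  shows "2 \<le> sum weight {v \<in> V. f v = i}"
proof -
  let ?C = "{v \<in> V. f v = i}"
  have fin: "finite ?C" using finite_V by simp
  \<comment> \<open>The closed neighborhood of any single vertex already shows all colors, so no
    class is empty.\<close>
  have "i \<in> f ` V" using f i V_nonempty by (force simp: fall_coloring_complement_iff)
  then obtain v where v: "v \<in> ?C" by blast
  show ?thesis
  proof (cases "nonisolated v")
    case True
    then obtain u where u: "u \<in> ?C" "u \<noteq> v" using fall_coloring_mate[OF f] v by blast
    have "sum weight {u, v} \<le> sum weight ?C"
      using fin u v by (intro sum_mono2) auto
    moreover have "weight u \<ge> 1" "weight v \<ge> 1" by (auto simp: weight_def)
    ultimately show ?thesis using u(2) by simp
  next
    case False
    then have "weight v = 2" by (simp add: weight_def)
    then show ?thesis using fin v member_le_sum[of v ?C weight] by auto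
  qed
qed

lemma sum_classes:
  assumes "coloring (complement_graph G) k f"
  shows "(\<Sum>i=1..k. sum weight {v \<in> V. f v = i}) = sum weight V"
  using assms finite_V by (intro sum.group) (auto simp: coloring_complement_iff)

text \<open>The total weight of the vertices is at least 2k by the fall coloring and at most 2k' by
  the other coloring.\<close>

lemma fall_coloring_minimal:
  assumes f: "fall_coloring (complement_graph G) k f"
    and f': "coloring (complement_graph G) k' f'"
  shows "k \<le> k'"
proof -
  have cf: "coloring (complement_graph G) k f" using f by (simp add: fall_coloring_def)
  have "(\<Sum>i=1..k. 2) \<le> (\<Sum>i=1..k. sum weight {v \<in> V. f v = i})"
    by (intro sum_mono fall_class_weight_ge[OF f])
  also have "\<dots> = (\<Sum>i=1..k'. sum weight {v \<in> V. f' v = i})"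
    using sum_classes[OF cf] sum_classes[OF f'] by simp
  also have "\<dots> \<le> (\<Sum>i=1..k'. 2)"
    by (intro sum_mono class_weight_le[OF f'])
  finally show ?thesis by simp
qed

lemma Fall_complement_subset: "Fall (complement_graph G) \<subseteq> {chromatic_number (complement_graph G)}"
proof
  fix k assume "k \<in> Fall (complement_graph G)"
  then obtain f where f: "fall_coloring (complement_graph G) k f" by (auto simp: Fall_def)
  have "chromatic_number (complement_graph G) = k"
    unfolding chromatic_number_def
    using f fall_coloring_minimal[OF f] by (intro Least_equality) (auto simp: fall_coloring_def)
  then show "k \<in> {chromatic_number (complement_graph G)}" by simp
qed

section \<open>Fall colorings as covering matchings\<close>

text \<open>A matching of \<open>G\<close> that covers all non-isolated vertices is described without reference to
  the two parts, as an injection along edges (a perfect matching of the bipartite double cover).\<close>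

definition covering :: "('a \<Rightarrow> 'a) \<Rightarrow> bool" where
  "covering \<sigma> \<longleftrightarrow> (\<forall>v. nonisolated v \<longrightarrow> (v, \<sigma> v) \<in> E) \<and> inj_on \<sigma> {v. nonisolated v}"

text \<open>The map sends a non-isolated vertex to another vertex of its class. Two vertices with a
  common image share a class, so they are adjacent and form a triangle with the image.\<close>

lemma fall_coloring_imp_covering:
  assumes f: "fall_coloring (complement_graph G) k f"
  shows "\<exists>\<sigma>. covering \<sigma>"
proof -
  obtain \<sigma> where \<sigma>: "\<sigma> v \<in> V" "\<sigma> v \<noteq> v" "f (\<sigma> v) = f v" if "nonisolated v" for v
    using fall_coloring_mate[OF f] by metis
  have adj: "(u, v) \<in> E" if "u \<in> V" "v \<in> V" "f u = f v" "u \<noteq> v" for u v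
    using f that by (auto simp: fall_coloring_def coloring_complement_iff)
  have edge: "(v, \<sigma> v) \<in> E" if "nonisolated v" for v
  proof -
    have "v \<in> V" using that E_in_V by blast
    then show ?thesis using adj[of v "\<sigma> v"] \<sigma>[OF that] by simp
  qed
  have "inj_on \<sigma> {v. nonisolated v}"
  proof (rule inj_onI, rule ccontr)
    fix u v assume uv: "u \<in> {v. nonisolated v}" "v \<in> {v. nonisolated v}" "\<sigma> u = \<sigma> v" "u \<noteq> v"
    then have n: "nonisolated u" "nonisolated v" by simp_all
    have "f u = f v" using \<sigma>(3)[OF n(1)] \<sigma>(3)[OF n(2)] uv(3) by simp
    then have "(u, v) \<in> E" using uv adj E_in_V by blast
    moreover have "(u, \<sigma> u) \<in> E" "(v, \<sigma> u) \<in> E"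
      using uv(3) edge[OF n(1)] edge[OF n(2)] by simp_all
    ultimately show False using triangle_free by blast
  qed
  with edge show ?thesis unfolding covering_def by blast
qed

text \<open>As \<open>\<sigma>\<close> need not be an involution, only its restriction from one part
  to the other is used as a matching. Its edges and the isolated vertices become the color
  classes.\<close>

lemma covering_imp_Fall:
  assumes "covering \<sigma>"
  shows "Fall (complement_graph G) \<noteq> {}"
proof -
  have \<sigma>: "(v, \<sigma> v) \<in> E" if "nonisolated v" for v using assms that by (auto simp: covering_def)
  have inj: "inj_on \<sigma> {v. nonisolated v}" using assms by (simp add: covering_def)
  obtain A B where AB: "A \<union> B = V" "A \<inter> B = {}" "\<And>u v. (u, v) \<in> E \<Longrightarrow> u \<in> A \<longleftrightarrow> v \<in> B"
    "\<And>u v. (u, v) \<in> E \<Longrightarrow> u \<in> B \<longleftrightarrow> v \<in> A" using parts by blast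
  define A' where "A' = {v \<in> A. nonisolated v}"
  define B' where "B' = {v \<in> B. nonisolated v}"
  have fin: "finite A'" "finite B'" using AB(1) finite_V
    by (auto simp: A'_def B'_def intro: finite_subset[of _ V])
  have sub: "\<sigma> ` A' \<subseteq> B'" "\<sigma> ` B' \<subseteq> A'"
    using \<sigma> AB E_sym by (auto simp: A'_def B'_def) blast+
  have injs: "inj_on \<sigma> A'" "inj_on \<sigma> B'"
    by (rule inj_on_subset[OF inj], auto simp: A'_def B'_def)+
  \<comment> \<open>\<open>\<sigma>\<close> injects each of \<open>A'\<close> and \<open>B'\<close>
    into the other, so both have the same size and the injection into \<open>B'\<close> is
    onto.\<close>
  have "card B' \<le> card A'" using sub injs fin by (metis card_image card_mono)
  then have bij: "\<sigma> ` A' = B'"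
    using sub injs fin by (metis card_image card_seteq)
  \<comment> \<open>A class is named by its vertex outside \<open>B'\<close>; the bijection
    \<open>h\<close> below turns these names into colors.\<close>
  define rep where "rep v = (if v \<in> B' then inv_into A' \<sigma> v else v)" for v
  define W where "W = rep ` V"
  have rep_B: "rep v \<in> A'" "\<sigma> (rep v) = v" if "v \<in> B'" for v
    using that bij by (auto simp: rep_def inv_into_into f_inv_into_f)
  have "finite W" using finite_V by (simp add: W_def)
  obtain h where h: "bij_betw h W {1..card W}"
    using ex_bij_betw_finite_nat[OF \<open>finite W\<close>]
    by (metis \<open>finite W\<close> card_atLeastAtMost diff_Suc_1 finite_atLeastAtMost finite_same_card_bij)
  define f where "f = h \<circ> rep"
  have f_eq: "f u = f v \<longleftrightarrow> rep u = rep v" if "u \<in> V" "v \<in> V" for u v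
    using that h by (auto simp: f_def W_def bij_betw_def inj_on_def)
  have range: "f ` V = {1..card W}"
    using h by (auto simp: f_def W_def bij_betw_def image_comp)
  have edge: "(u, v) \<in> E" if "u \<in> V" "v \<in> V" "rep u = rep v" "u \<noteq> v" for u v
  proof (cases "u \<in> B'")
    case True
    then have "v \<notin> B'" using that rep_B by metis
    then have "rep u = v" using that by (simp add: rep_def)
    then have "nonisolated v" "\<sigma> v = u" using rep_B[OF True] by (auto simp: A'_def)
    then show ?thesis using \<sigma>[of v] E_sym by metis
  next
    case False
    then have "v \<in> B'" using that by (auto simp: rep_def split: if_splits)
    then have "rep v = u" using that False by (simp add: rep_def)
    then have "nonisolated u" "\<sigma> u = v" using rep_B[OF \<open>v \<in> B'\<close>] by (auto simp: A'_def)
    then show ?thesis using \<sigma>[of u] by simp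
  qed
  \<comment> \<open>If a vertex \<open>w\<close> of color \<open>i\<close> is adjacent to
    \<open>v\<close>, then its partner \<open>u\<close> has the same color and is not adjacent to
    \<open>v\<close>, as \<open>G\<close> has no triangles.\<close>
  have "i \<in> f ` {u \<in> V. (v, u) \<notin> E}" if v: "v \<in> V" and i: "i \<in> {1..card W}" for i v
  proof -
    obtain w where w: "w \<in> V" "f w = i" using i range by (metis imageE)
    show ?thesis
    proof (cases "(v, w) \<in> E")
      case False
      then show ?thesis using w by blast
    next
      case True
      then have n: "nonisolated w" using E_sym by blast
      obtain u where u: "(w, u) \<in> E" "rep u = rep w"
      proof (cases "w \<in> B'")
        case True
        then have "rep w \<in> A'" "\<sigma> (rep w) = w" using rep_B by auto
        moreover from this have "nonisolated (rep w)" "rep w \<notin> B'"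
          using AB(2) by (auto simp: A'_def B'_def)
        ultimately have "(w, rep w) \<in> E" "rep (rep w) = rep w"
          using \<sigma>[of "rep w"] E_sym by (auto simp: rep_def[of "rep w"])
        then show ?thesis using that by blast
      next
        case False
        then have "w \<in> A'" using n w AB by (auto simp: A'_def B'_def)
        then have "\<sigma> w \<in> B'" using sub by auto
        then have "rep (\<sigma> w) = w" using rep_B[of "\<sigma> w"] \<open>w \<in> A'\<close> injs by (auto dest: inj_onD)
        then show ?thesis using that[of "\<sigma> w"] \<sigma>[OF n] False by (auto simp: rep_def)
      qed
      then have "(v, u) \<notin> E" using True triangle_free by blast
      then show ?thesis using u w f_eq E_in_V(2)[OF u(1)] by (metis (mono_tags, lifting) imageI mem_Collect_eq)
    qed
  qed
  moreover have "f ` {u \<in> V. (v, u) \<notin> E} \<subseteq> {1..card W}" for v using range by auto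
  ultimately have "fall_coloring (complement_graph G) (card W) f"
    using range edge f_eq
    by (auto simp: fall_coloring_complement_iff coloring_complement_iff simp del: atLeastAtMost_iff)
  moreover have "card W \<ge> 1"
    using V_nonempty \<open>finite W\<close> by (simp add: W_def Suc_le_eq card_gt_0_iff)
  ultimately show ?thesis by (auto simp: Fall_def)
qed

lemma Fall_complement_eq_iff:
  "Fall (complement_graph G) = {chromatic_number (complement_graph G)} \<longleftrightarrow> (\<exists>\<sigma>. covering \<sigma>)"
proof
  assume "Fall (complement_graph G) = {chromatic_number (complement_graph G)}"
  then show "\<exists>\<sigma>. covering \<sigma>" using fall_coloring_imp_covering by (auto simp: Fall_def)
next
  assume "\<exists>\<sigma>. covering \<sigma>"
  then show "Fall (complement_graph G) = {chromatic_number (complement_graph G)}"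
    using covering_imp_Fall Fall_complement_subset by blast
qed

end

section \<open>The auction\<close>

locale auction =
  fixes n :: nat and adj :: "nat \<Rightarrow> nat \<Rightarrow> bool"
begin

abbreviation active where "active a \<equiv> \<exists>b<n. adj a b"

definition perfect :: "(nat \<Rightarrow> nat) \<Rightarrow> bool" where
  "perfect \<sigma> \<longleftrightarrow>
    (\<forall>a<n. active a \<longrightarrow> \<sigma> a < n \<and> adj a (\<sigma> a)) \<and> inj_on \<sigma> {a. a < n \<and> active a}"

text \<open>Object \<open>b\<close> has price \<open>p b\<close>; the value \<open>own b = Suc a\<close> means that it belongs to bidder \<open>a\<close>,
  and \<open>own b = 0\<close> that it was never sold.\<close>

definition invariant :: "(nat \<Rightarrow> nat) \<Rightarrow> (nat \<Rightarrow> nat) \<Rightarrow> bool" where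
  "invariant p own \<longleftrightarrow>
    (\<forall>b<n. 0 < p b \<longrightarrow> 0 < own b) \<and>
    (\<forall>a. \<forall>b<n. own b = Suc a \<longrightarrow> a < n \<and> adj a b \<and> (\<forall>b'<n. adj a b' \<longrightarrow> p b \<le> Suc (p b'))) \<and>
    (\<forall>a. \<forall>b<n. \<forall>b'<n. own b = Suc a \<longrightarrow> own b' = Suc a \<longrightarrow> b = b') \<and>
    ((\<exists>\<sigma>. perfect \<sigma>) \<longrightarrow> (\<forall>b<n. p b \<le> Suc n))"

text \<open>The third fact is complementary slackness up to the bid increment 1: no alternative of
  an owner is cheaper by more than 1. The last one reflects that no bid is made at a price above
  \<open>n\<close>.\<close>

lemma invariantD:
  assumes "invariant p own" "b < n"
  shows "0 < p b \<Longrightarrow> 0 < own b"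
    and "own b = Suc a \<Longrightarrow> a < n \<and> adj a b"
    and "own b = Suc a \<Longrightarrow> b' < n \<Longrightarrow> adj a b' \<Longrightarrow> p b \<le> Suc (p b')"
    and "own b = Suc a \<Longrightarrow> b' < n \<Longrightarrow> own b' = Suc a \<Longrightarrow> b = b'"
    and "perfect \<sigma> \<Longrightarrow> p b \<le> Suc n"
  using assms unfolding invariant_def by blast+

definition settled :: "(nat \<Rightarrow> nat) \<Rightarrow> nat \<Rightarrow> bool" where
  "settled own a \<longleftrightarrow> (active a \<longrightarrow> (\<exists>b<n. own b = Suc a))"

text \<open>Some value \<open>c \<le> n\<close> is not the price of any object.  The owners of the objects above price
  \<open>c\<close>, together with \<open>a\<close>, would be too many for these objects.\<close>

lemma cheap_neighbor:
  assumes inv: "invariant p own" and \<sigma>: "perfect \<sigma>"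
    and a: "a < n" "active a" "\<forall>b<n. own b \<noteq> Suc a"
  shows "\<exists>b<n. adj a b \<and> p b \<le> n"
proof (rule ccontr)
  assume "\<not> ?thesis"
  then have exp: "n < p b" if "b < n" "adj a b" for b using that by (meson not_le)
  \<comment> \<open>The \<open>n\<close> objects cannot take all of the \<open>n + 1\<close> prices
    up to \<open>n\<close>.\<close>
  have "\<not> {..n} \<subseteq> p ` {..<n}"
    using surj_card_le[of "{..<n}" "{..n}" p] by auto
  then obtain c where c: "c \<le> n" "\<And>b. b < n \<Longrightarrow> p b \<noteq> c" by auto
  define S where "S = {b. b < n \<and> c < p b}"
  have fin: "finite S" by (simp add: S_def)
  have own: "0 < own b" if "b \<in> S" for b using invariantD(1)[OF inv] that by (simp add: S_def)
  define X where "X = insert a ((\<lambda>b. own b - 1) ` S)"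
  have "inj_on (\<lambda>b. own b - 1) S"
  proof (rule inj_onI)
    fix b b' assume b: "b \<in> S" "b' \<in> S" "own b - 1 = own b' - 1"
    then obtain x where "own b = Suc x" "own b' = Suc x"
      using own[of b] own[of b'] by (cases "own b"; cases "own b'") auto
    then show "b = b'" using invariantD(4)[OF inv] b by (simp add: S_def)
  qed
  moreover have "a \<notin> (\<lambda>b. own b - 1) ` S"
  proof
    assume "a \<in> (\<lambda>b. own b - 1) ` S"
    then obtain b where "b \<in> S" "a = own b - 1" by blast
    with own[of b] a(3) show False by (auto simp: S_def)
  qed
  ultimately have card: "card X = Suc (card S)" using fin by (simp add: X_def card_image)
  have X: "x < n \<and> active x \<and> (\<forall>b<n. adj x b \<longrightarrow> b \<in> S)" if "x \<in> X" for x
  proof (cases "x = a")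
    case True
    have "b \<in> S" if "b < n" "adj a b" for b
      using exp[OF that] c(1) that by (simp add: S_def)
    then show ?thesis using True a(1,2) by blast
  next
    case False
    then obtain b where b: "b \<in> S" "x = own b - 1" using \<open>x \<in> X\<close> by (auto simp: X_def)
    then have "own b = Suc x" using own[of b] by simp
    moreover have "b < n" using b by (simp add: S_def)
    ultimately have x: "x < n" "adj x b" "\<And>b'. b' < n \<Longrightarrow> adj x b' \<Longrightarrow> p b \<le> Suc (p b')"
      using invariantD[OF inv] by blast+
    \<comment> \<open>By slackness a neighbor of this owner costs at least \<open>c\<close>. Since
      \<open>c\<close> is not a price, it costs more and lies in \<open>S\<close>.\<close>
    have "b' \<in> S" if "b' < n" "adj x b'" for b'
    proof -
      have "c < p b" "p b \<le> Suc (p b')" using b(1) x(3) that by (simp_all add: S_def)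
      then have "c \<le> p b'" by simp
      then show ?thesis using c(2)[OF that(1)] that by (simp add: S_def)
    qed
    then show ?thesis using x(1,2) \<open>b < n\<close> by blast
  qed
  have "\<sigma> ` X \<subseteq> S" using X \<sigma> unfolding perfect_def by blast
  moreover have "X \<subseteq> {x. x < n \<and> active x}" using X by blast
  then have "inj_on \<sigma> X" using \<sigma> inj_on_subset unfolding perfect_def by blast
  ultimately have "card X \<le> card S" using fin by (metis card_image card_mono)
  then show False using card by simp
qed

section \<open>Bids and the end of the auction\<close>

lemma invariant_init: "invariant (\<lambda>_. 0) (\<lambda>_. 0)"
  by (simp add: invariant_def)

text \<open>Prices never fall, so the slackness of the other owners persists; that of
  \<open>a\<close> holds because \<open>b\<close> is a cheapest neighbor. The ceiling on prices
  survives since \<open>cheap_neighbor\<close> puts the price of \<open>b\<close> at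
  \<open>n\<close> or less before the bid.\<close>

lemma invariant_bid:
  assumes inv: "invariant p own" and a: "a < n" "\<forall>b<n. own b \<noteq> Suc a"
    and b: "b < n" "adj a b" "\<forall>b'<n. adj a b' \<longrightarrow> p b \<le> p b'"
  shows "invariant (p(b := Suc (p b))) (own(b := Suc a))"
proof -
  let ?p = "p(b := Suc (p b))" and ?own = "own(b := Suc a)"
  have mono: "p c \<le> ?p c" for c by simp
  note i = invariantD[OF inv]
  have "0 < ?own c" if "0 < ?p c" "c < n" for c
    using i(1)[of c] that by (cases "c = b") simp_all
  moreover have "x < n \<and> adj x c \<and> (\<forall>c'<n. adj x c' \<longrightarrow> ?p c \<le> Suc (?p c'))"
    if "?own c = Suc x" "c < n" for c x
  proof (cases "c = b")
    case True
    then have "x = a" using that by simp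
    moreover have "Suc (p b) \<le> Suc (?p c')" if "c' < n" "adj a c'" for c'
    proof -
      have "p b \<le> p c'" using b(3) that by blast
      then show ?thesis using mono[of c'] by linarith
    qed
    ultimately show ?thesis using True a(1) b(2) by simp
  next
    case False
    then have x: "own c = Suc x" using that by simp
    have "p c \<le> Suc (?p c')" if "c' < n" "adj x c'" for c'
      using i(3)[OF \<open>c < n\<close> x that] mono[of c'] by linarith
    then show ?thesis using i(2)[OF \<open>c < n\<close> x] False by simp
  qed
  moreover have "c = c'" if "?own c = Suc x" "?own c' = Suc x" "c < n" "c' < n" for c c' x
    using that a(2) i(4)[of c x c'] by (simp split: if_splits)
  moreover have "?p c \<le> Suc n" if "perfect \<sigma>" "c < n" for \<sigma> c
  proof -
    have "p b \<le> n" using cheap_neighbor[OF inv that(1) a(1) _ a(2)] b by (meson le_trans)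
    then show ?thesis using i(5)[OF that(2,1)] by simp
  qed
  ultimately show ?thesis unfolding invariant_def by blast
qed

text \<open>An object has a single owner, so objects chosen for different bidders differ.\<close>

lemma settled_perfect:
  assumes inv: "invariant p own" and s: "\<forall>a<n. settled own a"
  shows "\<exists>\<sigma>. perfect \<sigma>"
proof -
  obtain \<sigma> where \<sigma>: "\<sigma> a < n" "own (\<sigma> a) = Suc a" if "a < n" "active a" for a
    using s unfolding settled_def by metis
  have "inj_on \<sigma> {a. a < n \<and> active a}"
  proof (rule inj_onI)
    fix x y assume xy: "x \<in> {a. a < n \<and> active a}" "y \<in> {a. a < n \<and> active a}"
      and eq: "\<sigma> x = \<sigma> y"
    have "own (\<sigma> x) = Suc x" "own (\<sigma> y) = Suc y" using xy \<sigma>(2) by blast+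
    then have "Suc x = Suc y" unfolding eq by (rule trans[OF sym])
    then show "x = y" by (rule Suc_inject)
  qed
  moreover have "adj a (\<sigma> a)" if "a < n" "active a" for a
    using invariantD(2)[OF inv \<sigma>[OF that]] by simp
  ultimately show ?thesis using \<sigma>(1) unfolding perfect_def by blast
qed

text \<open>Every bid raises this sum by 1, so if a perfect assignment exists, the number of bids is
  bounded as well.\<close>

lemma price_sum_bound:
  assumes inv: "invariant p own" and "perfect \<sigma>"
  shows "(\<Sum>b<n. p b) \<le> n * Suc n"
  using invariantD(5)[OF assms(1) _ assms(2)] sum_bounded_above[of "{..<n}" p "Suc n"] by simp

end

section \<open>Structured programs\<close>

text \<open>Only backward jumps of loops and forward jumps of \<open>Unless\<close> occur, both of which are
  conditional, so no register has to be reserved for unconditional jumps.\<close>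

datatype com =
    Block "instr list"
  | Seq com com  (infixr \<open>;;\<close> 60)
  | Unless nat com
  | Repeat com nat

type_synonym registers = "nat \<Rightarrow> nat"

text \<open>Jump targets are absolute, which is why the address \<open>l\<close> of the first
  instruction is a parameter.\<close>

fun compile :: "com \<Rightarrow> nat \<Rightarrow> instr list" where
  "compile (Block is) l = is"
| "compile (c ;; d) l = compile c l @ compile d (l + length (compile c l))"
| "compile (Unless i c) l = JumpPos i (Suc l + length (compile c (Suc l))) # compile c (Suc l)"
| "compile (Repeat c i) l = compile c l @ [JumpPos i l]"

text \<open>Quantifying over \<open>pre\<close> and \<open>post\<close> makes the code relocatable,
  as its composition requires. Control leaves it right behind its last instruction.\<close>

definition triple ::
  "bool list \<Rightarrow> (registers \<Rightarrow> bool) \<Rightarrow> com \<Rightarrow> nat \<Rightarrow> (registers \<Rightarrow> bool) \<Rightarrow> bool" where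
  "triple w P c T Q \<longleftrightarrow>
    (\<forall>pre post R. P R \<longrightarrow> (\<exists>t\<le>T. \<exists>R'. Q R' \<and>
      (step (pre @ compile c (length pre) @ post) w ^^ t) (length pre, R) =
        (length pre + length (compile c (length pre)), R')))"

lemma triple_run:
  assumes "triple w P c T Q" "P (\<lambda>_. 0)"
  shows "\<exists>t\<le>T. halted (compile c 0) (run (compile c 0) w t) \<and> Q (snd (run (compile c 0) w t))"
  using assms(1)[unfolded triple_def, rule_format, of "\<lambda>_. 0" "[]" "[]"] assms(2)
  by (fastforce simp: run_def halted_def)

lemma triple_weaken:
  assumes "triple w P c T Q" "\<And>R. P' R \<Longrightarrow> P R" "\<And>R. Q R \<Longrightarrow> Q' R" "T \<le> T'"
  shows "triple w P' c T' Q'"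
  using assms unfolding triple_def by (meson order_trans)

text \<open>With the initial registers fixed, witnesses of an existential precondition can serve as
  parameters of all later assertions.\<close>

lemma triple_pointwise:
  assumes "\<And>R. P R \<Longrightarrow> triple w ((=) R) c T Q"
  shows "triple w P c T Q"
  using assms unfolding triple_def by blast

lemma triple_Seq:
  assumes c: "triple w P c T Q" and d: "triple w Q d T' S"
  shows "triple w P (c ;; d) (T + T') S"
  unfolding triple_def
proof (intro allI impI)
  fix pre post :: "instr list" and R :: registers assume "P R"
  let ?c = "compile c (length pre)"
  let ?d = "compile d (length (pre @ ?c))"
  let ?s = "step (pre @ ?c @ ?d @ post) w"
  obtain t R' where 1: "t \<le> T" "Q R'" "(?s ^^ t) (length pre, R) = (length (pre @ ?c), R')"
    using c[unfolded triple_def, rule_format, OF \<open>P R\<close>, of pre "?d @ post"] by auto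
  obtain t' R'' where 2: "t' \<le> T'" "S R''"
    "(?s ^^ t') (length (pre @ ?c), R') = (length (pre @ ?c) + length ?d, R'')"
    using d[unfolded triple_def, rule_format, OF \<open>Q R'\<close>, of "pre @ ?c" post] by auto
  have "(?s ^^ (t' + t)) (length pre, R) = (length (pre @ ?c) + length ?d, R'')"
    using 1(3) 2(3) by (simp add: funpow_add)
  then show "\<exists>t\<le>T + T'. \<exists>R'. S R' \<and>
      (step (pre @ compile (c ;; d) (length pre) @ post) w ^^ t) (length pre, R) =
        (length pre + length (compile (c ;; d) (length pre)), R')"
    using 1(1) 2(1,2) by (intro exI[of _ "t' + t"] conjI exI[of _ R'']) (auto simp: add.assoc)
qed

lemma step_nth: "step (pre @ i # post) w (length pre, R) = exec w i (length pre, R)"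
  by (simp add: step_def halted_def)

lemma triple_Unless:
  assumes c: "triple w P c T Q"
  shows "triple w (\<lambda>R. if R i = 0 then P R else Q R) (Unless i c) (Suc T) Q"
  unfolding triple_def
proof (intro allI impI)
  fix pre post :: "instr list" and R :: registers assume R: "if R i = 0 then P R else Q R"
  let ?c = "compile c (Suc (length pre))"
  let ?j = "JumpPos i (Suc (length pre) + length ?c)"
  let ?s = "step (pre @ (?j # ?c) @ post) w"
  have s: "?s (length pre, R) = (if R i > 0 then Suc (length pre) + length ?c else length pre + 1, R)"
    using step_nth[of pre ?j "?c @ post"] by simp
  have "\<exists>t\<le>Suc T. \<exists>R'. Q R' \<and> (?s ^^ t) (length pre, R) = (length pre + length (?j # ?c), R')"
  proof (cases "R i = 0")
    case True
    then have "P R" using R by simp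
    then obtain t R' where t: "t \<le> T" "Q R'"
      "(?s ^^ t) (Suc (length pre), R) = (Suc (length pre) + length ?c, R')"
      using c[unfolded triple_def, rule_format, of R "pre @ [?j]" post] by auto
    have "(?s ^^ Suc t) (length pre, R) = (length pre + length (?j # ?c), R')"
      using t(3) s True by (simp add: funpow_swap1[symmetric] del: funpow.simps(2)
          add: funpow_Suc_right)
    then show ?thesis using t(1,2) by (intro exI[of _ "Suc t"]) auto
  next
    case False
    then show ?thesis using s R by (intro exI[of _ 1]) auto
  qed
  then show "\<exists>t\<le>Suc T. \<exists>R'. Q R' \<and>
      (step (pre @ compile (Unless i c) (length pre) @ post) w ^^ t) (length pre, R) =
        (length pre + length (compile (Unless i c) (length pre)), R')"
    by simp
qed

text \<open>The invariant \<open>I k\<close> holds when \<open>k\<close> iterations are left.\<close>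

lemma triple_Repeat:
  assumes c: "\<And>k. triple w (I (Suc k)) c T (\<lambda>R. I k R \<and> (R i = 0 \<longleftrightarrow> k = 0))" and "0 < n"
  shows "triple w (I n) (Repeat c i) (n * Suc T) (I 0)"
  unfolding triple_def
proof (intro allI impI)
  fix pre post :: "instr list" and R :: registers assume "I n R"
  let ?c = "compile c (length pre)"
  let ?j = "JumpPos i (length pre)"
  let ?s = "step (pre @ (?c @ [?j]) @ post) w"
  have "\<exists>t\<le>n * Suc T. \<exists>R'. I 0 R' \<and>
    (?s ^^ t) (length pre, R) = (length pre + length (?c @ [?j]), R')"
    using \<open>0 < n\<close> \<open>I n R\<close>
  proof (induction n arbitrary: R)
    case 0
    then show ?case by simp
  next
    case (Suc n)
    obtain t R' where t: "t \<le> T" "I n R'" "R' i = 0 \<longleftrightarrow> n = 0"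
      "(?s ^^ t) (length pre, R) = (length pre + length ?c, R')"
      using c[unfolded triple_def, rule_format, OF \<open>I (Suc n) R\<close>, of pre "[?j] @ post"] by auto
    have s: "(?s ^^ Suc t) (length pre, R) =
      (if n = 0 then length pre + length (?c @ [?j]) else length pre, R')"
      using t(3,4) step_nth[of "pre @ ?c" ?j post w R'] by (cases "n = 0") simp_all
    show ?case
    proof (cases "n = 0")
      case True
      then show ?thesis using t s by (intro exI[of _ "Suc t"] conjI exI[of _ R']) simp_all
    next
      case False
      then obtain t' R'' where t': "t' \<le> n * Suc T" "I 0 R''"
        "(?s ^^ t') (length pre, R') = (length pre + length (?c @ [?j]), R'')"
        using Suc.IH[OF _ t(2)] by auto
      have "(?s ^^ (t' + Suc t)) (length pre, R) = (?s ^^ t') ((?s ^^ Suc t) (length pre, R))"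
        by (simp only: funpow_add comp_apply)
      then have "(?s ^^ (t' + Suc t)) (length pre, R) = (length pre + length (?c @ [?j]), R'')"
        using s t'(3) False by simp
      moreover have "t' + Suc t \<le> Suc n * Suc T" using t(1) t'(1) by simp
      ultimately show ?thesis using t'(2) by blast
    qed
  qed
  then show "\<exists>t\<le>n * Suc T. \<exists>R'. I 0 R' \<and>
      (step (pre @ compile (Repeat c i) (length pre) @ post) w ^^ t) (length pre, R) =
        (length pre + length (compile (Repeat c i) (length pre)), R')"
    by simp
qed

section \<open>Loop-free code\<close>

definition straight :: "instr \<Rightarrow> bool" where
  "straight ins \<longleftrightarrow> (\<forall>i l. ins \<noteq> JumpPos i l)"

lemma straight_simps [simp]:
  "straight (Const i c)" "straight (Add i j k)" "straight (Sub i j k)"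
  "straight (Load i j)" "straight (Store i j)" "straight (Read i j)"
  by (simp_all add: straight_def)

definition effect :: "bool list \<Rightarrow> instr \<Rightarrow> registers \<Rightarrow> registers" where
  "effect w ins R = snd (exec w ins (0, R))"

lemma effect_simps [simp]:
  "effect w (Const i c) R = R(i := c)"
  "effect w (Add i j k) R = R(i := R j + R k)"
  "effect w (Sub i j k) R = R(i := R j - R k)"
  "effect w (Load i j) R = R(i := R (R j))"
  "effect w (Store i j) R = R(R i := R j)"
  "effect w (Read i j) R = R(i := input_symbol w (R j))"
  by (simp_all add: effect_def)

lemma triple_Block:
  assumes "list_all straight is"
  shows "triple w (\<lambda>R. Q (fold (effect w) is R)) (Block is) (length is) Q"
proof -
  have "(step (pre @ is @ post) w ^^ length is) (length pre, R) =
    (length pre + length is, fold (effect w) is R)" for pre post R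
    using assms
  proof (induction "is" arbitrary: pre R)
    case Nil
    then show ?case by simp
  next
    case (Cons i "is")
    have "step (pre @ i # is @ post) w (length pre, R) = (length (pre @ [i]), effect w i R)"
      using Cons.prems by (cases i) (simp_all add: step_nth straight_def)
    then show ?case
      using Cons.IH[of "pre @ [i]" "effect w i R"] Cons.prems
      by (simp add: funpow_Suc_right del: funpow.simps(2))
  qed
  then show ?thesis unfolding triple_def by auto
qed

text \<open>The next three functions are only meaningful for programs without \<open>Repeat\<close>.\<close>

fun loopfree :: "com \<Rightarrow> bool" where
  "loopfree (Block is) \<longleftrightarrow> list_all straight is"
| "loopfree (c ;; d) \<longleftrightarrow> loopfree c \<and> loopfree d"
| "loopfree (Unless i c) \<longleftrightarrow> loopfree c"
| "loopfree (Repeat c i) \<longleftrightarrow> False"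

fun cost :: "com \<Rightarrow> nat" where
  "cost (Block is) = length is"
| "cost (c ;; d) = cost c + cost d"
| "cost (Unless i c) = Suc (cost c)"
| "cost (Repeat c i) = 0"

fun meaning :: "bool list \<Rightarrow> com \<Rightarrow> registers \<Rightarrow> registers" where
  "meaning w (Block is) R = fold (effect w) is R"
| "meaning w (c ;; d) R = meaning w d (meaning w c R)"
| "meaning w (Unless i c) R = (if R i = 0 then meaning w c R else R)"
| "meaning w (Repeat c i) R = R"

lemma triple_meaning:
  "loopfree c \<Longrightarrow> triple w (\<lambda>R. Q (meaning w c R)) c (cost c) Q"
proof (induction c arbitrary: Q)
  case (Block "is")
  then show ?case by (simp add: triple_Block)
next
  case (Seq c d)
  then have c: "triple w (\<lambda>R. Q (meaning w d (meaning w c R))) c (cost c) (\<lambda>R. Q (meaning w d R))"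
    and d: "triple w (\<lambda>R. Q (meaning w d R)) d (cost d) Q"
    by simp_all
  show ?case using triple_Seq[OF c d] by simp
next
  case (Unless i c)
  then have "triple w (\<lambda>R. Q (meaning w c R)) c (cost c) Q" by simp
  from triple_Unless[OF this, of i] show ?case
    by (rule triple_weaken) auto
next
  case (Repeat c i)
  then show ?case by simp
qed

text \<open>Verifying loop-free code is thereby reduced to evaluating \<open>meaning\<close>, which
  the simplifier can do.\<close>

lemma triple_loopfree:
  assumes "loopfree c" "cost c \<le> T" "\<And>R. P R \<Longrightarrow> Q (meaning w c R)"
  shows "triple w P c T Q"
  by (rule triple_weaken[OF triple_meaning[OF assms(1), of w Q]]) (use assms in auto)

section \<open>The program\<close>

abbreviation (input) "rAns \<equiv> 0::nat"
abbreviation (input) "rOne \<equiv> 2::nat"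
abbreviation (input) "rTwo \<equiv> 3::nat"
abbreviation (input) "rZero \<equiv> 4::nat"
abbreviation (input) "rBase \<equiv> 5::nat"
abbreviation (input) "rN \<equiv> 6::nat"
abbreviation (input) "rLen \<equiv> 7::nat"
abbreviation (input) "rRounds \<equiv> 8::nat"
abbreviation (input) "rA \<equiv> 9::nat"
abbreviation (input) "rB \<equiv> 10::nat"
abbreviation (input) "rPos \<equiv> 11::nat"
abbreviation (input) "rFound \<equiv> 12::nat"
abbreviation (input) "rBest \<equiv> 13::nat"
abbreviation (input) "rPrice \<equiv> 14::nat"
abbreviation (input) "rP \<equiv> 15::nat"
abbreviation (input) "rQ \<equiv> 16::nat"
abbreviation (input) "rT \<equiv> 17::nat"
abbreviation (input) "rU \<equiv> 18::nat"
abbreviation (input) "rX \<equiv> 19::nat"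
abbreviation (input) "rY \<equiv> 20::nat"
abbreviation (input) "rSq \<equiv> 21::nat"

text \<open>The price of \<open>b\<close> is stored in register \<open>22 + b\<close>, its owner in \<open>22 + b + n\<close>.  An iteration of
  \<open>scan_step\<close> looks for \<open>a\<close> among the owners, and for the address \<open>rBest\<close> of a cheapest neighbor
  of \<open>a\<close> (0 if there is none so far).  As vertices are visited in descending order, so is the
  adjacency matrix.\<close>

definition scan_step :: com where
  "scan_step =
    Block [Sub rB rB rOne, Sub rPos rPos rOne, Add rP rBase rB, Add rQ rP rN, Load rX rQ,
      Add rT rA rOne, Sub rU rX rT, Sub rT rT rX, Add rT rT rU] ;;
    Unless rT (Block [Const rFound 1]) ;;
    Block [Read rX rPos, Sub rT rOne rX] ;;
    Unless rT
      (Block [Load rY rP] ;;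
       Unless rBest (Block [Add rPrice rY rZero]) ;;
       Block [Sub rU rY rPrice] ;;
       Unless rU (Block [Add rPrice rY rZero, Add rBest rP rZero]))"

text \<open>\<open>rT\<close> is 0 exactly if a neighbor was found and \<open>a\<close> owns
  nothing. Adding \<open>n\<close> to the address of a price gives the address of the owner.\<close>

definition place_bid :: com where
  "place_bid =
    Block [Sub rT rOne rBest, Add rT rT rFound] ;;
    Unless rT
      (Block [Add rPrice rPrice rOne, Store rBest rPrice, Add rBest rBest rN, Add rU rA rOne,
        Store rBest rU, Const rAns 0])"

definition bid_step :: com where
  "bid_step =
    Block [Sub rA rA rOne, Const rFound 0, Const rBest 0, Add rB rN rZero] ;;
    Repeat scan_step rB ;;
    place_bid"

text \<open>A bid clears \<open>rAns\<close>, so the value 1 survives exactly a round without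
  bids.\<close>

definition round_step :: com where
  "round_step =
    Block [Sub rRounds rRounds rOne, Const rAns 1, Add rPos rLen rZero, Add rA rN rZero] ;;
    Repeat bid_step rA"

text \<open>Reading stops at the symbol 2 behind the end of the word. Position 0 is skipped, so the
  word must be nonempty.\<close>

definition input_length :: com where
  "input_length = Repeat (Block [Add rLen rLen rOne, Read rX rLen, Sub rT rTwo rX]) rT"

text \<open>From m^2 to (m + 1)^2 one adds m and m + 1, which avoids multiplication.\<close>

definition square_root :: com where
  "square_root =
    Repeat (Block [Add rSq rSq rN, Add rN rN rOne, Add rSq rSq rN, Sub rT rLen rSq]) rT"

text \<open>The n^2 + 2n + 1 rounds exceed n^2 + n, the bound on the total price under a perfect
  assignment. The arrays start at 22, behind all named registers.\<close>

definition program :: com where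
  "program =
    Block [Const rOne 1, Const rTwo 2, Const rBase 22] ;;
    input_length ;;
    square_root ;;
    Block [Add rRounds rLen rN, Add rRounds rRounds rN, Add rRounds rRounds rOne] ;;
    Repeat round_step rRounds"

lemma matrix_index:
  fixes a b m n :: nat
  assumes "a < m" "b < n"
  shows "a * n + b < m * n"
proof -
  have "a * n + b < Suc a * n" using assms by simp
  also have "\<dots> \<le> m * n" using \<open>a < m\<close> by (intro mult_le_mono1) simp
  finally show ?thesis .
qed

section \<open>Verification of the program\<close>

locale matrix_input =
  fixes w :: "bool list" and n :: nat
  assumes length_w: "length w = n * n" and n_pos: "0 < n"
begin

sublocale auction n "\<lambda>a b. w ! (a * n + b)" .

abbreviation adj where "adj a b \<equiv> w ! (a * n + b)"

lemma input_symbol_adj: "a < n \<Longrightarrow> b < n \<Longrightarrow> input_symbol w (a * n + b) = of_bool (adj a b)"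
  using matrix_index length_w by (simp add: input_symbol_def)

definition memory :: "(nat \<Rightarrow> nat) \<Rightarrow> (nat \<Rightarrow> nat) \<Rightarrow> registers \<Rightarrow> bool" where
  "memory p own R \<longleftrightarrow> R rOne = 1 \<and> R rZero = 0 \<and> R rBase = 22 \<and> R rN = n \<and> R rLen = n * n \<and>
    (\<forall>b<n. R (22 + b) = p b \<and> R (22 + b + n) = own b)"

definition best_among :: "(nat \<Rightarrow> nat) \<Rightarrow> nat \<Rightarrow> nat \<Rightarrow> registers \<Rightarrow> bool" where
  "best_among p a k R \<longleftrightarrow>
    (if R rBest = 0 then \<forall>b\<ge>k. b < n \<longrightarrow> \<not> adj a b
     else \<exists>b\<ge>k. b < n \<and> adj a b \<and> R rBest = 22 + b \<and> R rPrice = p b \<and>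
       (\<forall>b'\<ge>k. b' < n \<longrightarrow> adj a b' \<longrightarrow> p b \<le> p b'))"

text \<open>The objects from \<open>k\<close> on have been scanned and \<open>k\<close> iterations
  are left, the form that \<open>triple_Repeat\<close> asks for.\<close>

definition scanning ::
  "(nat \<Rightarrow> nat) \<Rightarrow> (nat \<Rightarrow> nat) \<Rightarrow> nat \<Rightarrow> nat \<Rightarrow> nat \<Rightarrow> nat \<Rightarrow> registers \<Rightarrow> bool" where
  "scanning p own ans r a k R \<longleftrightarrow> memory p own R \<and> R rAns = ans \<and> R rRounds = r \<and> R rA = a \<and>
    a < n \<and> R rB = k \<and> k \<le> n \<and> R rPos = a * n + k \<and>
    (0 < R rFound \<longleftrightarrow> (\<exists>b\<ge>k. b < n \<and> own b = Suc a)) \<and> best_among p a k R"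

lemma all_ge_Suc: "(\<forall>b\<ge>k. P b) \<longleftrightarrow> P k \<and> (\<forall>b\<ge>Suc k. P b)" for k :: nat
  by (metis Suc_leD le_antisym not_less_eq_eq order_refl)

lemma ex_ge_Suc: "(\<exists>b\<ge>k. P b) \<longleftrightarrow> P k \<or> (\<exists>b\<ge>Suc k. P b)" for k :: nat
  using all_ge_Suc[of k "\<lambda>b. \<not> P b"] by blast

lemma scan_step:
  "triple w (scanning p own ans r a (Suc k)) scan_step 21
     (\<lambda>R. scanning p own ans r a k R \<and> (R rB = 0 \<longleftrightarrow> k = 0))"
proof (rule triple_loopfree)
  fix R assume R: "scanning p own ans r a (Suc k) R"
  have mem: "R rOne = 1" "R rZero = 0" "R rBase = 22" "R rN = n" "R rLen = n * n"
    "\<And>b. b < n \<Longrightarrow> R (22 + b) = p b" "\<And>b. b < n \<Longrightarrow> R (22 + b + n) = own b"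
    and reg: "R rAns = ans" "R rRounds = r" "R rA = a" "R rB = Suc k" "R rPos = Suc (a * n + k)"
    and less: "a < n" "k < n"
    and found: "0 < R rFound \<longleftrightarrow> (\<exists>b\<ge>Suc k. b < n \<and> own b = Suc a)"
    and best: "best_among p a (Suc k) R"
    using R by (simp_all add: scanning_def memory_def)
  have inp: "input_symbol w (a * n + k) = of_bool (adj a k)"
    using input_symbol_adj less by simp
  have k: "R (22 + k) = p k" "R (22 + k + n) = own k" using mem less by simp_all
  let ?R = "meaning w scan_step R"
  let ?better = "adj a k \<and> (R rBest = 0 \<or> p k \<le> R rPrice)"
  \<comment> \<open>Registers 10 to 20 are the working registers of the scan. Truncated subtraction
    supplies the tests: \<open>rT\<close> is first the distance of \<open>own k\<close> and
    \<open>Suc a\<close>, and \<open>rU\<close> is 0 exactly if the new price is at most the best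
    one. A first neighbor is compared with itself.\<close>
  have *: "(\<forall>x. x \<notin> {10..20} \<longrightarrow> ?R x = R x) \<and> ?R rB = k \<and> ?R rPos = a * n + k \<and>
    ?R rFound = (if own k = Suc a then 1 else R rFound) \<and>
    ?R rBest = (if ?better then 22 + k else R rBest) \<and>
    ?R rPrice = (if ?better then p k else R rPrice)"
    by (cases "own k" "Suc a" rule: linorder_cases; cases "adj a k"; cases "R rBest = 0";
        cases "p k \<le> R rPrice")
      (simp_all add: scan_step_def mem(1-5) reg k inp)
  have split: "b = k \<or> Suc k \<le> b" if "k \<le> b" for b using that by linarith
  have "best_among p a k ?R"
  proof (cases ?better)
    case True
    have "p k \<le> p b" if "k \<le> b" "b < n" "adj a b" for b
    proof (cases "b = k")
      case False
      then have "Suc k \<le> b" using split that by blast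
      then show ?thesis
        using best True that unfolding best_among_def by (cases "R rBest = 0") force+
    qed simp
    then show ?thesis using * True less(2) by (auto simp: best_among_def)
  next
    case False
    show ?thesis
    proof (cases "R rBest = 0")
      case True
      then have "\<not> adj a b" if "k \<le> b" "b < n" for b
        using best False split[OF that(1)] that unfolding best_among_def by auto
      then show ?thesis using * True False by (auto simp: best_among_def)
    next
      case nz: False
      then obtain b where b: "Suc k \<le> b" "b < n" "adj a b" "R rBest = 22 + b" "R rPrice = p b"
        "\<And>b'. Suc k \<le> b' \<Longrightarrow> b' < n \<Longrightarrow> adj a b' \<Longrightarrow> p b \<le> p b'"
        using best unfolding best_among_def by auto
      have "p b \<le> p b'" if "k \<le> b'" "b' < n" "adj a b'" for b'
        using split[OF that(1)] b(5,6) that False by auto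
      then show ?thesis using * nz False b(1-5) unfolding best_among_def
        by (auto intro!: exI[of _ b])
    qed
  qed
  moreover have "memory p own ?R" using * mem by (simp add: memory_def)
  ultimately show "scanning p own ans r a k ?R \<and> (?R rB = 0 \<longleftrightarrow> k = 0)"
    using * reg less found ex_ge_Suc[of k "\<lambda>b. b < n \<and> own b = Suc a"]
    by (simp add: scanning_def)
qed (simp_all add: scan_step_def)

text \<open>\<open>p\<^sub>0\<close> and \<open>own\<^sub>0\<close> are the state at the start of
  the round. A round with bids must have started with an unsettled bidder, so a final state is never
  left again.\<close>

definition bidding ::
  "(nat \<Rightarrow> nat) \<Rightarrow> (nat \<Rightarrow> nat) \<Rightarrow> nat \<Rightarrow> nat \<Rightarrow> registers \<Rightarrow> bool" where
  "bidding p\<^sub>0 own\<^sub>0 r k R \<longleftrightarrow> (\<exists>p own. memory p own R \<and> invariant p own \<and>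
    R rRounds = r \<and> R rA = k \<and> k \<le> n \<and> R rPos = k * n \<and>
    (R rAns = 1 \<and> p = p\<^sub>0 \<and> own = own\<^sub>0 \<and> (\<forall>a\<ge>k. a < n \<longrightarrow> settled own\<^sub>0 a) \<or>
     R rAns = 0 \<and> \<not> (\<forall>a<n. settled own\<^sub>0 a) \<and> sum p\<^sub>0 {..<n} < sum p {..<n}))"

lemma sum_price_bid:
  fixes p :: "nat \<Rightarrow> nat"
  shows "b < n \<Longrightarrow> sum (p(b := Suc (p b))) {..<n} = Suc (sum p {..<n})"
  using sum.remove[of "{..<n}" b p] sum.remove[of "{..<n}" b "p(b := Suc (p b))"]
  by (simp add: sum.cong[of "{..<n} - {b}" _ "p(b := Suc (p b))" p])

lemma bid:
  assumes R: "scanning p own ans r a 0 R" and inv: "invariant p own"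
    and ans: "ans = 1 \<and> p = p\<^sub>0 \<and> own = own\<^sub>0 \<and> (\<forall>a'\<ge>Suc a. a' < n \<longrightarrow> settled own\<^sub>0 a') \<or>
     ans = 0 \<and> \<not> (\<forall>a<n. settled own\<^sub>0 a) \<and> sum p\<^sub>0 {..<n} < sum p {..<n}"
  defines "R' \<equiv> meaning w place_bid R"
  shows "bidding p\<^sub>0 own\<^sub>0 r a R'"
proof -
  have mem: "memory p own R" and reg: "R rAns = ans" "R rRounds = r" "R rA = a" "R rPos = a * n"
    and a: "a < n" and found: "0 < R rFound \<longleftrightarrow> (\<exists>b<n. own b = Suc a)" and best: "best_among p a 0 R"
    using R by (simp_all add: scanning_def)
  have const: "R rOne = 1" "R rZero = 0" "R rBase = 22" "R rN = n" "R rLen = n * n"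
    and arr: "\<And>b. b < n \<Longrightarrow> R (22 + b) = p b" "\<And>b. b < n \<Longrightarrow> R (22 + b + n) = own b"
    using mem by (simp_all add: memory_def)
  show ?thesis
  proof (cases "0 < R rFound \<or> R rBest = 0")
    case True
    then have same: "R' x = R x" if "x \<noteq> rT" for x
    proof (elim disjE)
      assume "0 < R rFound"
      then have "R rFound \<noteq> 0" by simp
      then show ?thesis using that by (simp add: R'_def place_bid_def)
    next
      assume "R rBest = 0"
      then show ?thesis using that by (simp add: R'_def place_bid_def const(1))
    qed
    have "settled own a"
    proof (cases "R rBest = 0")
      case True
      then have "\<not> active a" using best by (simp add: best_among_def)
      then show ?thesis unfolding settled_def by blast
    next
      case False
      then have "\<exists>b<n. own b = Suc a" using True found by simp
      then show ?thesis unfolding settled_def by blast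
    qed
    then have "\<forall>a'\<ge>a. a' < n \<longrightarrow> settled own a'" if "\<forall>a'\<ge>Suc a. a' < n \<longrightarrow> settled own a'"
      using that unfolding all_ge_Suc[of a] by blast
    then have "ans = 1 \<and> p = p\<^sub>0 \<and> own = own\<^sub>0 \<and> (\<forall>a'\<ge>a. a' < n \<longrightarrow> settled own\<^sub>0 a') \<or>
        ans = 0 \<and> \<not> (\<forall>a<n. settled own\<^sub>0 a) \<and> sum p\<^sub>0 {..<n} < sum p {..<n}"
      using ans by blast
    moreover have "memory p own R'" using mem by (simp add: memory_def same)
    moreover have "R' rAns = ans" "R' rRounds = r" "R' rA = a" "R' rPos = a * n"
      using reg by (simp_all add: same)
    ultimately show ?thesis
      using inv a less_imp_le unfolding bidding_def by blast
  next
    case False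
    then obtain b where b: "b < n" "adj a b" "R rBest = 22 + b" "R rPrice = p b"
      "\<forall>b'<n. adj a b' \<longrightarrow> p b \<le> p b'"
      using best by (auto simp: best_among_def)
    have unsold: "\<forall>b<n. own b \<noteq> Suc a" using False found by blast
    have "R rFound = 0" using False by simp
    note eqs = R'_def place_bid_def reg const(1,4) b(3,4) this
    \<comment> \<open>13, 14, 17 and 18 are \<open>rBest\<close>, \<open>rPrice\<close>,
      \<open>rT\<close> and \<open>rU\<close>, which \<open>place_bid\<close> overwrites.\<close>
    have low: "R' x = (if x = rAns then 0 else R x)" if "x < 22" "x \<notin> {13, 14, 17, 18}" for x
      using that by (simp add: eqs)
    have high: "R' x = (if x = 22 + b + n then Suc a else if x = 22 + b then Suc (p b) else R x)"
      if "22 \<le> x" for x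
      using that by (simp add: eqs)
    let ?p = "p(b := Suc (p b))" and ?own = "own(b := Suc a)"
    have "\<not> settled own a" using unsold b by (auto simp: settled_def)
    \<comment> \<open>Before the first bid of the round \<open>own\<close> is still
      \<open>own\<^sub>0\<close>, and \<open>a\<close> is the unsettled bidder; after it the claim
      is part of \<open>ans\<close>.\<close>
    then have "\<not> (\<forall>a<n. settled own\<^sub>0 a)" using ans a by blast
    moreover have "memory ?p ?own R'"
      unfolding memory_def
    proof (intro conjI allI impI)
      fix c assume c: "c < n"
      show "R' (22 + c) = ?p c" using c b(1) arr(1)[OF c] by (simp add: high)
      show "R' (22 + c + n) = ?own c" using c b(1) arr(2)[OF c] by (simp add: high)
    qed (simp_all add: low const)
    moreover have "invariant ?p ?own" by (rule invariant_bid[OF inv a unsold b(1,2,5)])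
    moreover have "sum p\<^sub>0 {..<n} < sum ?p {..<n}"
      using ans unfolding sum_price_bid[OF b(1)] by (elim disjE conjE) simp_all
    moreover have "R' rAns = 0" "R' rRounds = r" "R' rA = a" "R' rPos = a * n"
      using reg by (simp_all add: low)
    ultimately show ?thesis
      using a less_imp_le unfolding bidding_def by blast
  qed
qed

lemma bid_step:
  "triple w (bidding p\<^sub>0 own\<^sub>0 r (Suc a)) bid_step (4 + (n * 22 + 9))
    (\<lambda>R. bidding p\<^sub>0 own\<^sub>0 r a R \<and> (R rA = 0 \<longleftrightarrow> a = 0))"
proof (rule triple_pointwise)
  fix R assume "bidding p\<^sub>0 own\<^sub>0 r (Suc a) R"
  then obtain p own where R: "memory p own R" "invariant p own" "R rRounds = r" "R rA = Suc a"
    "Suc a \<le> n" "R rPos = Suc a * n"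
    and ans: "R rAns = 1 \<and> p = p\<^sub>0 \<and> own = own\<^sub>0 \<and> (\<forall>a'\<ge>Suc a. a' < n \<longrightarrow> settled own\<^sub>0 a') \<or>
     R rAns = 0 \<and> \<not> (\<forall>a<n. settled own\<^sub>0 a) \<and> sum p\<^sub>0 {..<n} < sum p {..<n}"
    unfolding bidding_def by blast
  have init: "triple w ((=) R) (Block [Sub rA rA rOne, Const rFound 0, Const rBest 0, Add rB rN rZero]) 4
    (scanning p own (R rAns) r a n)"
    by (rule triple_loopfree) (use R in \<open>auto simp: scanning_def memory_def best_among_def\<close>)
  have scan: "triple w (scanning p own (R rAns) r a n) (Repeat scan_step rB) (n * 22)
    (scanning p own (R rAns) r a 0)"
    using triple_Repeat[of w "scanning p own (R rAns) r a", OF scan_step n_pos] by simp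
  have place: "triple w (scanning p own (R rAns) r a 0) place_bid 9
    (\<lambda>R. bidding p\<^sub>0 own\<^sub>0 r a R \<and> (R rA = 0 \<longleftrightarrow> a = 0))"
  proof (rule triple_loopfree)
    fix R' assume "scanning p own (R rAns) r a 0 R'"
    then have "bidding p\<^sub>0 own\<^sub>0 r a (meaning w place_bid R')"
      using bid[OF _ R(2) ans] by blast
    moreover from this have "meaning w place_bid R' rA = a" unfolding bidding_def by blast
    ultimately show "bidding p\<^sub>0 own\<^sub>0 r a (meaning w place_bid R') \<and>
        (meaning w place_bid R' rA = 0 \<longleftrightarrow> a = 0)" by simp
  qed (simp_all add: place_bid_def)
  show "triple w ((=) R) bid_step (4 + (n * 22 + 9))
    (\<lambda>R. bidding p\<^sub>0 own\<^sub>0 r a R \<and> (R rA = 0 \<longleftrightarrow> a = 0))"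
    unfolding bid_step_def by (rule triple_Seq[OF init triple_Seq[OF scan place]])
qed

text \<open>A round with bids uses up one round but raises the total price by at least 1, so their
  sum does not drop below \<open>T\<close>. A round without bids ends with everyone settled.\<close>

lemma round_step:
  "triple w
     (\<lambda>R. \<exists>p own. memory p own R \<and> invariant p own \<and> R rRounds = Suc k \<and>
       (R rAns = 1 \<and> (\<forall>a<n. settled own a) \<or> R rAns = 0 \<and> T \<le> sum p {..<n} + Suc k))
     round_step (4 + n * (22 * n + 14))
     (\<lambda>R. (\<exists>p own. memory p own R \<and> invariant p own \<and> R rRounds = k \<and>
       (R rAns = 1 \<and> (\<forall>a<n. settled own a) \<or> R rAns = 0 \<and> T \<le> sum p {..<n} + k)) \<and>
       (R rRounds = 0 \<longleftrightarrow> k = 0))" (is "triple w ?P _ _ ?Q")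
proof (rule triple_pointwise)
  fix R assume "?P R"
  then obtain p own where R: "memory p own R" "invariant p own" "R rRounds = Suc k"
    and ans: "R rAns = 1 \<and> (\<forall>a<n. settled own a) \<or> R rAns = 0 \<and> T \<le> sum p {..<n} + Suc k"
    by blast
  have "triple w (bidding p own k n) (Repeat bid_step rA) (n * Suc (4 + (n * 22 + 9)))
      (bidding p own k 0)"
    using triple_Repeat[of w "bidding p own k", OF bid_step n_pos] by simp
  then have "triple w (bidding p own k n) (Repeat bid_step rA) (n * (22 * n + 14)) ?Q"
  proof (rule triple_weaken)
    fix R assume "bidding p own k 0 R"
    then obtain p' own' where R': "memory p' own' R" "invariant p' own'" "R rRounds = k"
      and "R rAns = 1 \<and> p' = p \<and> own' = own \<and> (\<forall>a\<ge>0. a < n \<longrightarrow> settled own a) \<or>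
        R rAns = 0 \<and> \<not> (\<forall>a<n. settled own a) \<and> sum p {..<n} < sum p' {..<n}"
      unfolding bidding_def by blast
    with ans have "R rAns = 1 \<and> (\<forall>a<n. settled own' a) \<or> R rAns = 0 \<and> T \<le> sum p' {..<n} + k"
      by auto
    then show "?Q R" using R' by blast
  qed (simp_all add: algebra_simps)
  moreover have "triple w ((=) R)
      (Block [Sub rRounds rRounds rOne, Const rAns 1, Add rPos rLen rZero, Add rA rN rZero]) 4
      (bidding p own k n)"
    by (rule triple_loopfree)
      (use R in \<open>auto simp: bidding_def memory_def intro!: exI[of _ p] exI[of _ own]\<close>)
  ultimately show "triple w ((=) R) round_step (4 + n * (22 * n + 14)) ?Q"
    unfolding round_step_def by (intro triple_Seq)
qed

section \<open>Preprocessing of the input word\<close>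

lemma input_length:
  "triple w (\<lambda>R. R rLen = 0 \<and> R rOne = 1 \<and> R rTwo = 2 \<and>
      (\<forall>x. x \<notin> {rOne, rTwo, rBase} \<longrightarrow> R x = 0) \<and> R rBase = 22)
    input_length (n * n * 4)
    (\<lambda>R. R rLen = n * n \<and> R rOne = 1 \<and> R rBase = 22 \<and>
      (\<forall>x. x \<notin> {rOne, rTwo, rBase, rLen, rX, rT} \<longrightarrow> R x = 0))"
proof -
  define I where "I k R \<longleftrightarrow> R rLen + k = n * n \<and> R rOne = 1 \<and> R rTwo = 2 \<and> R rBase = 22 \<and>
      (\<forall>x. x \<notin> {rOne, rTwo, rBase, rLen, rX, rT} \<longrightarrow> R x = 0)" for k and R :: registers
  have "triple w (I (Suc k)) (Block [Add rLen rLen rOne, Read rX rLen, Sub rT rTwo rX]) 3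
      (\<lambda>R. I k R \<and> (R rT = 0 \<longleftrightarrow> k = 0))" for k
  proof (rule triple_loopfree)
    fix R assume R: "I (Suc k) R"
    then have "input_symbol w (Suc (R rLen)) = 2 \<longleftrightarrow> k = 0"
      "input_symbol w (Suc (R rLen)) \<le> 2"
      by (auto simp: I_def input_symbol_def length_w)
    then show "I k (meaning w (Block [Add rLen rLen rOne, Read rX rLen, Sub rT rTwo rX]) R) \<and>
      (meaning w (Block [Add rLen rLen rOne, Read rX rLen, Sub rT rTwo rX]) R rT = 0 \<longleftrightarrow> k = 0)"
      using R by (auto simp: I_def)
  qed simp_all
  from triple_Repeat[of w I, OF this, of "n * n"] n_pos
  have "triple w (I (n * n)) input_length (n * n * 4) (I 0)"
    by (simp add: input_length_def)
  then show ?thesis by (rule triple_weaken) (auto simp: I_def)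
qed

lemma square_root:
  "triple w (\<lambda>R. R rLen = n * n \<and> R rOne = 1 \<and> R rBase = 22 \<and>
      (\<forall>x. x \<notin> {rOne, rTwo, rBase, rLen, rX, rT} \<longrightarrow> R x = 0))
    square_root (n * 5)
    (\<lambda>R. R rN = n \<and> R rLen = n * n \<and> R rOne = 1 \<and> R rBase = 22 \<and>
      (\<forall>x. x \<notin> {rOne, rTwo, rBase, rLen, rX, rT, rN, rSq} \<longrightarrow> R x = 0))"
proof -
  define I where "I k R \<longleftrightarrow> R rN + k = n \<and> R rSq = R rN * R rN \<and> R rLen = n * n \<and> R rOne = 1 \<and>
      R rBase = 22 \<and> (\<forall>x. x \<notin> {rOne, rTwo, rBase, rLen, rX, rT, rN, rSq} \<longrightarrow> R x = 0)"
    for k and R :: registers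
  let ?c = "Block [Add rSq rSq rN, Add rN rN rOne, Add rSq rSq rN, Sub rT rLen rSq]"
  have "triple w (I (Suc k)) ?c 4 (\<lambda>R. I k R \<and> (R rT = 0 \<longleftrightarrow> k = 0))" for k
  proof (rule triple_loopfree)
    fix R assume R: "I (Suc k) R"
    let ?m = "R rN"
    have n: "Suc ?m + k = n" using R by (simp add: I_def)
    \<comment> \<open>\<open>rT\<close> is a truncated difference that vanishes once the square
      reaches \<open>n * n\<close>; strictness excludes an earlier stop.\<close>
    have "Suc ?m * Suc ?m < n * n" if "k \<noteq> 0"
      using n that by (intro mult_strict_mono) auto
    then have "n * n \<le> Suc ?m * Suc ?m \<longleftrightarrow> k = 0" using n by fastforce
    then show "I k (meaning w ?c R) \<and> (meaning w ?c R rT = 0 \<longleftrightarrow> k = 0)"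
      using R n by (auto simp: I_def)
  qed simp_all
  from triple_Repeat[of w I, OF this n_pos]
  have "triple w (I n) square_root (n * 5) (I 0)"
    by (simp add: square_root_def)
  then show ?thesis by (rule triple_weaken) (auto simp: I_def)
qed

lemma program:
  "triple w (\<lambda>R. R = (\<lambda>_. 0)) program
    (3 + (n * n * 4 + (n * 5 + (3 + (n * n + n + n + 1) * (22 * n * n + 14 * n + 5)))))
    (\<lambda>R. R rAns = of_bool (\<exists>\<sigma>. perfect \<sigma>))"
proof -
  let ?T = "n * n + n + n + 1"
  define I where "I k R \<longleftrightarrow> (\<exists>p own. memory p own R \<and> invariant p own \<and> R rRounds = k \<and>
      (R rAns = 1 \<and> (\<forall>a<n. settled own a) \<or> R rAns = 0 \<and> ?T \<le> sum p {..<n} + k))"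
    for k and R :: registers
  have "triple w (I (Suc k)) round_step (4 + n * (22 * n + 14)) (\<lambda>R. I k R \<and> (R rRounds = 0 \<longleftrightarrow> k = 0))"
    for k
    using round_step[of k ?T] unfolding I_def .
  then have "triple w (I ?T) (Repeat round_step rRounds) (?T * Suc (4 + n * (22 * n + 14))) (I 0)"
    by (rule triple_Repeat) simp
  then have rounds: "triple w (I ?T) (Repeat round_step rRounds) (?T * (22 * n * n + 14 * n + 5))
    (\<lambda>R. R rAns = of_bool (\<exists>\<sigma>. perfect \<sigma>))"
  proof (rule triple_weaken)
    fix R assume "I 0 R"
    then obtain p own where inv: "invariant p own"
      and "R rAns = 1 \<and> (\<forall>a<n. settled own a) \<or> R rAns = 0 \<and> ?T \<le> sum p {..<n}"
      unfolding I_def by auto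
    then show "R rAns = of_bool (\<exists>\<sigma>. perfect \<sigma>)"
    proof (elim disjE conjE)
      assume "R rAns = 1" "\<forall>a<n. settled own a"
      then show ?thesis using settled_perfect[OF inv] by simp
    next
      assume "R rAns = 0" "?T \<le> sum p {..<n}"
      \<comment> \<open>With no rounds left the prices sum to at least n^2 + 2n + 1, beyond the
        bound for a perfect assignment.\<close>
      moreover have "\<not> perfect \<sigma>" for \<sigma>
        using price_sum_bound[OF inv] \<open>?T \<le> sum p {..<n}\<close> by fastforce
      ultimately show ?thesis by simp
    qed
  qed (simp_all add: algebra_simps)
  have start: "triple w (\<lambda>R. R rN = n \<and> R rLen = n * n \<and> R rOne = 1 \<and> R rBase = 22 \<and>
      (\<forall>x. x \<notin> {rOne, rTwo, rBase, rLen, rX, rT, rN, rSq} \<longrightarrow> R x = 0))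
    (Block [Add rRounds rLen rN, Add rRounds rRounds rN, Add rRounds rRounds rOne]) 3 (I ?T)"
  proof (rule triple_loopfree)
    fix R :: registers
    assume "R rN = n \<and> R rLen = n * n \<and> R rOne = 1 \<and> R rBase = 22 \<and>
      (\<forall>x. x \<notin> {rOne, rTwo, rBase, rLen, rX, rT, rN, rSq} \<longrightarrow> R x = 0)"
    then show "I ?T (meaning w (Block [Add rRounds rLen rN, Add rRounds rRounds rN,
        Add rRounds rRounds rOne]) R)"
      \<comment> \<open>Registers not yet written are 0: this is the auction before any bid, with
        answer 0 and all \<open>?T\<close> rounds left.\<close>
      unfolding I_def using invariant_init
      by (intro exI[of _ "\<lambda>_. 0"]) (simp add: memory_def)
  qed simp_all
  have init: "triple w (\<lambda>R. R = (\<lambda>_. 0)) (Block [Const rOne 1, Const rTwo 2, Const rBase 22]) 3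
    (\<lambda>R. R rLen = 0 \<and> R rOne = 1 \<and> R rTwo = 2 \<and>
      (\<forall>x. x \<notin> {rOne, rTwo, rBase} \<longrightarrow> R x = 0) \<and> R rBase = 22)"
    by (rule triple_loopfree) simp_all
  show ?thesis
    unfolding program_def
    by (rule triple_Seq[OF init triple_Seq[OF input_length triple_Seq[OF square_root
      triple_Seq[OF start rounds]]]])
qed

end

section \<open>Adjacency matrices and the polynomial bound\<close>

lemma concat_matrix:
  fixes f :: "nat \<Rightarrow> nat \<Rightarrow> 'b" and n :: nat
  defines "M m \<equiv> concat (map (\<lambda>i. map (f i) [0..<n]) [0..<m])"
  shows length_concat_matrix: "length (M m) = m * n"
    and nth_concat_matrix: "i < m \<Longrightarrow> j < n \<Longrightarrow> M m ! (i * n + j) = f i j"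
proof -
  \<comment> \<open>The number \<open>m\<close> of rows is kept apart from the row length
    \<open>n\<close>, so that induction can append one row at a time.\<close>
  have M_Suc: "M (Suc m) = M m @ map (f m) [0..<n]" for m by (simp add: M_def)
  show len: "length (M m) = m * n" for m
    by (induction m) (simp_all add: M_Suc, simp add: M_def)
  show "i < m \<Longrightarrow> j < n \<Longrightarrow> M m ! (i * n + j) = f i j"
  proof (induction m)
    case (Suc m)
    show ?case
    proof (cases "i = m")
      case True
      then show ?thesis using Suc.prems by (simp add: M_Suc nth_append len)
    next
      case False
      then have "i < m" using Suc.prems by simp
      then show ?thesis
        using Suc matrix_index[OF \<open>i < m\<close> \<open>j < n\<close>] by (simp add: M_Suc nth_append len)
    qed
  qed simp
qed

lemma adjacency_word_correct:
  assumes "card (pverts G) = n"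
  shows "length (adjacency_word G) = n * n"
    and "i < n \<Longrightarrow> j < n \<Longrightarrow> adjacency_word G ! (i * n + j) \<longleftrightarrow> (i, j) \<in> parcs G"
proof -
  have "adjacency_word G = concat (map (\<lambda>i. map (\<lambda>j. (i, j) \<in> parcs G) [0..<n]) [0..<n])"
    using assms by (simp add: adjacency_word_def Let_def)
  then show "length (adjacency_word G) = n * n"
    "i < n \<Longrightarrow> j < n \<Longrightarrow> adjacency_word G ! (i * n + j) \<longleftrightarrow> (i, j) \<in> parcs G"
    using length_concat_matrix[of "\<lambda>i j. (i, j) \<in> parcs G" n n]
      nth_concat_matrix[of i n j n "\<lambda>i j. (i, j) \<in> parcs G"] by simp_all
qed

lemma program_decides_Fall:
  assumes "input_graph G" "bipartite G"
  defines "w \<equiv> adjacency_word G"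
  shows "\<exists>t \<le> poly ([:6, 9:] + [:1, 3:] * [:5, 36:]) (length w).
    halted (compile program 0) (run (compile program 0) w t) \<and>
    snd (run (compile program 0) w t) 0 =
      of_bool (Fall (complement_graph G) = {chromatic_number (complement_graph G)})"
proof -
  define n where "n = card (pverts G)"
  interpret bipartite_graph G
    using assms(1,2) by unfold_locales (simp_all add: input_graph_def)
  have V: "pverts G = {..<n}" using assms(1) by (simp add: input_graph_def n_def)
  have "0 < n" using V V_nonempty by (cases n) auto
  interpret matrix_input w n
    using adjacency_word_correct(1)[OF n_def[symmetric]] \<open>0 < n\<close>
    by unfold_locales (simp_all add: w_def)
  have adj: "w ! (a * n + b) \<longleftrightarrow> (a, b) \<in> parcs G" if "a < n" "b < n" for a b
    using adjacency_word_correct(2)[OF n_def[symmetric]] that by (simp add: w_def)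
  have less: "a < n" "b < n" if "(a, b) \<in> parcs G" for a b
    using E_in_V[OF that] V by simp_all
  have active: "a < n \<and> active a \<longleftrightarrow> nonisolated a" for a
    using adj less by blast
  \<comment> \<open>Every vertex is a bidder as well as an object, so both notions ask for the same
    injection along edges.\<close>
  have "perfect \<sigma> \<longleftrightarrow> covering \<sigma>" for \<sigma>
  proof -
    have "\<sigma> a < n \<and> w ! (a * n + \<sigma> a) \<longleftrightarrow> (a, \<sigma> a) \<in> parcs G" if "a < n" for a
      using adj[OF that] less(2) by blast
    then have "(\<forall>a<n. active a \<longrightarrow> \<sigma> a < n \<and> w ! (a * n + \<sigma> a)) \<longleftrightarrow>
        (\<forall>a. a < n \<and> active a \<longrightarrow> (a, \<sigma> a) \<in> parcs G)"
      by blast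
    then show ?thesis unfolding perfect_def covering_def by (simp only: active)
  qed
  then have eq: "(\<exists>\<sigma>. perfect \<sigma>) \<longleftrightarrow> Fall (complement_graph G) = {chromatic_number (complement_graph G)}"
    using Fall_complement_eq_iff by simp
  let ?N = "n * n"
  \<comment> \<open>This turns the bound in \<open>n\<close> into one in the word length N, namely 6
    + 9N + (1 + 3N)(5 + 36N).\<close>
  have "n \<le> ?N" by (simp add: le_square)
  then have "22 * ?N + 14 * n + 5 \<le> 5 + 36 * ?N" "?N + n + n + 1 \<le> 1 + 3 * ?N" by linarith+
  then have prod: "(?N + n + n + 1) * (22 * n * n + 14 * n + 5) \<le> (1 + 3 * ?N) * (5 + 36 * ?N)"
    by (intro mult_le_mono) (simp_all only: mult.assoc)
  have "3 + (?N * 4 + (n * 5 + (3 + (?N + n + n + 1) * (22 * n * n + 14 * n + 5))))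
      \<le> 3 + (?N * 4 + (?N * 5 + (3 + (1 + 3 * ?N) * (5 + 36 * ?N))))"
    using \<open>n \<le> ?N\<close> by (intro add_left_mono add_mono mult_le_mono1 prod)
  also have "\<dots> = poly ([:6, 9:] + [:1, 3:] * [:5, 36:]) (length w)"
    by (simp add: length_w algebra_simps)
  finally show ?thesis
    using triple_run[OF program refl] unfolding eq by (meson order_trans)
qed

theorem theorem12:
  shows "(\<forall>G :: 'a pair_pre_digraph. simple_graph G \<longrightarrow> bipartite G \<longrightarrow>
            Fall (complement_graph G) \<subseteq> {chromatic_number (complement_graph G)}) \<and>
         decidable_in_polynomial_time
           {G. input_graph G \<and> bipartite G}
           adjacency_word
           (\<lambda>G. Fall (complement_graph G) = {chromatic_number (complement_graph G)})"
proof
  show "\<forall>G :: 'a pair_pre_digraph. simple_graph G \<longrightarrow> bipartite G \<longrightarrow>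
      Fall (complement_graph G) \<subseteq> {chromatic_number (complement_graph G)}"
    using bipartite_graph.Fall_complement_subset by (auto simp: bipartite_graph_def)
  show "decidable_in_polynomial_time {G. input_graph G \<and> bipartite G} adjacency_word
      (\<lambda>G. Fall (complement_graph G) = {chromatic_number (complement_graph G)})"
    unfolding decidable_in_polynomial_time_def using program_decides_Fall by blast
qed

end
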